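(* Let $n=p^{3}q$ with primes $2\leq p<q$. Let $\mathcal{D}_{S_{1}},\mathcal{D}_{S_{2}}$ be subsets of $\mathcal{D}_{[n]}\setminus\{n\}$. If $\mathrm{Spec}(\mathrm{ICG}(n,\mathcal{D}_{S_{1}}))=\mathrm{Spec}(\mathrm{ICG}(n,\mathcal{D}_{S_{2}}))$, then $\mathcal{D}_{S_{1}}=\mathcal{D}_{S_{2}}$.
   Context: For an integer $n\ge1$, identify $\mathbb{Z}_n$ with $[n]=\{1,\dots,n\}$ ($n$ playing the role of $0$). For a positive divisor $d$ of $n$, $G_n(d)=\{j\in[n]:\gcd(j,n)=d\}$. $\mathcal{D}_{[n]}$ denotes the set of all positive divisors of $n$. For $\mathcal{D}\subseteq\mathcal{D}_{[n]}\setminus\{n\}$, $\mathrm{ICG}(n,\mathcal{D})$ denotes the circulant graph $\mathrm{Cay}(\mathbb{Z}_n,S)$ with connection set $S=\bigcup_{d\in\mathcal{D}}G_n(d)$ (vertex set $\mathbb{Z}_n$, $g\sim h$ iff $h-g\in S$); we write $\mathcal{D}=\mathcal{D}_S$. $\mathrm{Spec}$ denotes the multiset of eigenvalues of the adjacency matrix. *)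

theory Defs
  imports "Jordan_Normal_Form.Char_Poly"
begin

definition Gn :: "nat \<Rightarrow> nat \<Rightarrow> nat set" where
  "Gn n d = {j \<in> {1..n}. gcd j n = d}"

definition ICG_conn :: "nat \<Rightarrow> nat set \<Rightarrow> nat set" where
  "ICG_conn n D = (\<Union>d\<in>D. Gn n d)"

text \<open>Adjacency matrix of ICG(n,D) = Cay(Z_n, S); vertex k in [n] is represented by
  the index k mod n in {0..<n}; g ~ h iff (h - g) mod n is in S (as residue, n playing 0).\<close>
definition ICG_adj :: "nat \<Rightarrow> nat set \<Rightarrow> complex mat" where
  "ICG_adj n D = mat n n (\<lambda>(i, j).
      if (\<exists>s\<in>ICG_conn n D. s mod n = (j + n - i) mod n) then 1 else 0)"

definition Spec :: "complex mat \<Rightarrow> complex multiset" where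
  "Spec A = proots (char_poly A)"

end

theory Submission
  imports Defs "HOL-Library.Indicator_Function" "HOL-Library.Real_Mod" "HOL-Number_Theory.Totient"
begin

text \<open>Let \<open>n = Nq\<close> with \<open>N = p\<^sup>k\<close>, and let \<open>f\<close> be the indicator of \<open>D\<close>. The eigenvalues of
  \<open>ICG(n, D)\<close> are the values of the discrete Fourier transform of \<open>s \<mapsto> f (gcd s n)\<close> and hence
  integers. Modulo \<open>q\<close> they agree with the transform of \<open>s \<mapsto> \<delta> (gcd s N)\<close> on \<open>\<int>\<^sub>N\<close>,
  where \<open>\<delta> d = f (dq) - f d\<close>, so that the residue of the \<open>j\<close>-th eigenvalue depends only on
  \<open>gcd j N\<close>. The degree is the largest eigenvalue, which settles the class \<open>gcd j N = N\<close>; the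
  other classes have superincreasing sizes, so the multiset of residues determines the residue on
  each of them. Inverting the transform over \<open>\<int>\<^sub>N\<close> gives \<open>\<delta>\<close> modulo \<open>q\<close>, hence exactly as
  \<open>q \<ge> 3\<close>; in particular it tells whether \<open>N \<in> D\<close>, as \<open>Nq \<notin> D\<close>. The degree then determines
  the number of \<open>s < N\<close> with \<open>gcd s N \<in> D\<close>, and by the superincreasing class sizes once more
  all divisors of \<open>N\<close> in \<open>D\<close>; their multiples by \<open>q\<close> are read off from \<open>\<delta>\<close>.\<close>

section \<open>Circulant matrices and the discrete Fourier transform\<close>

definition unity_root :: "nat \<Rightarrow> int \<Rightarrow> complex" where
  "unity_root n a = cis (2 * pi * of_int a / of_nat n)"

lemma unity_root_0 [simp]: "unity_root n 0 = 1"
  by (simp add: unity_root_def)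

lemma norm_unity_root [simp]: "norm (unity_root n a) = 1"
  by (simp add: unity_root_def)

lemma unity_root_add: "unity_root n (a + b) = unity_root n a * unity_root n b"
  by (simp add: unity_root_def cis_mult add_divide_distrib distrib_left)

lemma unity_root_power: "unity_root n a ^ t = unity_root n (int t * a)"
  by (simp add: unity_root_def DeMoivre mult_ac)

lemma unity_root_mult_cancel:
  assumes "m > 0"
  shows "unity_root (m * n) (int m * a) = unity_root n a"
  using assms by (simp add: unity_root_def mult.assoc)

lemma unity_root_eq_1_iff:
  assumes "n > 0"
  shows "unity_root n a = 1 \<longleftrightarrow> int n dvd a"
proof -
  have "2 * pi * of_int a / of_nat n = of_int b * (2 * pi) \<longleftrightarrow> a = int n * b" for b :: int
  proof -
    have "2 * pi * of_int a / of_nat n = of_int b * (2 * pi)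
        \<longleftrightarrow> (of_int a :: real) = of_int (int n * b)"
      using assms by (simp add: field_simps)
    then show ?thesis by (simp only: of_int_eq_iff)
  qed
  then show ?thesis
    by (simp add: unity_root_def cis_eq_1_iff dvd_def)
qed

lemma unity_root_cong:
  assumes "n > 0" and "[a = b] (mod int n)"
  shows "unity_root n a = unity_root n b"
  using unity_root_add[of n "a - b" b] unity_root_eq_1_iff[of n "a - b"] assms
  by (simp add: cong_iff_dvd_diff)

lemma sum_unity_root:
  assumes "n > 0"
  shows "(\<Sum>t<n. unity_root n (int t * a)) = (if int n dvd a then of_nat n else 0)"
proof (cases "int n dvd a")
  case True
  then have "unity_root n (int t * a) = 1" for t
    using assms by (simp add: unity_root_eq_1_iff)
  then show ?thesis using True by simp
next
  case False
  then have "unity_root n a \<noteq> 1" using assms by (simp add: unity_root_eq_1_iff)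
  then have "(\<Sum>t<n. unity_root n a ^ t) = (unity_root n a ^ n - 1) / (unity_root n a - 1)"
    by (rule geometric_sum)
  also have "unity_root n a ^ n = 1"
    using assms by (simp add: unity_root_power unity_root_eq_1_iff)
  finally show ?thesis using False by (simp add: unity_root_power)
qed

lemma sum_unity_root_multiples:
  assumes "m > 0" and "N > 0"
  shows "(\<Sum>s<m * N. of_bool (m dvd s) * unity_root (m * N) (int s * int j))
    = of_bool (N dvd j) * of_nat N"
proof -
  have "(\<Sum>s<m * N. of_bool (m dvd s) * unity_root (m * N) (int s * int j))
      = (\<Sum>s | s < m * N \<and> m dvd s. unity_root (m * N) (int s * int j))"
    by (intro sum.mono_neutral_cong_right) auto
  also have "\<dots> = (\<Sum>t<N. unity_root N (int t * int j))"
  proof (rule sum.reindex_bij_witness[of _ "\<lambda>t. m * t" "\<lambda>s. s div m"])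
    fix s assume "s \<in> {s. s < m * N \<and> m dvd s}"
    then obtain t where "s = m * t" by auto
    then show "unity_root N (int (s div m) * int j) = unity_root (m * N) (int s * int j)"
      using assms unity_root_mult_cancel[of m N "int t * int j"] by (simp add: mult.assoc)
  qed (use assms in \<open>auto simp: less_mult_imp_div_less mult.commute\<close>)
  also have "\<dots> = of_bool (N dvd j) * of_nat N"
    using sum_unity_root[OF assms(2), of "int j"] by simp
  finally show ?thesis .
qed

definition dft :: "nat \<Rightarrow> (nat \<Rightarrow> complex) \<Rightarrow> nat \<Rightarrow> complex" where
  "dft n f l = (\<Sum>s<n. f s * unity_root n (int s * int l))"

definition circulant_mat :: "nat \<Rightarrow> (nat \<Rightarrow> 'a) \<Rightarrow> 'a mat" where
  "circulant_mat n f = mat n n (\<lambda>(i, j). f ((j + n - i) mod n))"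

definition fourier_mat :: "nat \<Rightarrow> complex mat" where
  "fourier_mat n = mat n n (\<lambda>(j, l). unity_root n (int j * int l))"

lemma circulant_mat_carrier [simp]: "circulant_mat n f \<in> carrier_mat n n"
  by (simp add: circulant_mat_def)

lemma fourier_mat_carrier [simp]: "fourier_mat n \<in> carrier_mat n n"
  by (simp add: fourier_mat_def)

lemma fourier_mat_invertible:
  assumes "n > 0"
  obtains Q where "Q \<in> carrier_mat n n"
    and "fourier_mat n * Q = 1\<^sub>m n" and "Q * fourier_mat n = 1\<^sub>m n"
proof
  define Q where "Q = mat n n (\<lambda>(l, j). unity_root n (- (int l * int j)) / of_nat n)"
  show Q: "Q \<in> carrier_mat n n" by (simp add: Q_def)
  show inverse: "fourier_mat n * Q = 1\<^sub>m n"
  proof (rule eq_matI)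
    fix i j assume "i < dim_row (1\<^sub>m n)" "j < dim_col (1\<^sub>m n)"
    then have bounds: "i < n" "j < n" by auto
    then have "(fourier_mat n * Q) $$ (i, j)
        = (\<Sum>l<n. unity_root n (int i * int l) * (unity_root n (- (int l * int j)) / of_nat n))"
      by (simp add: fourier_mat_def Q_def scalar_prod_def atLeast0LessThan)
    also have "\<dots> = (\<Sum>l<n. unity_root n (int l * (int i - int j))) / of_nat n"
      by (simp add: sum_divide_distrib unity_root_add[symmetric] algebra_simps)
    also have "int n dvd int i - int j \<longleftrightarrow> i = j"
      using bounds by (auto simp: cong_iff_dvd_diff[symmetric] cong_int_iff
          dest: cong_less_modulus_unique_nat)
    then have "(\<Sum>l<n. unity_root n (int l * (int i - int j))) / of_nat n = 1\<^sub>m n $$ (i, j)"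
      using bounds assms by (simp add: sum_unity_root)
    finally show "(fourier_mat n * Q) $$ (i, j) = 1\<^sub>m n $$ (i, j)" .
  qed (auto simp: fourier_mat_def Q_def)
  show "Q * fourier_mat n = 1\<^sub>m n"
    by (rule mat_mult_left_right_inverse[OF fourier_mat_carrier Q inverse])
qed

lemma bij_betw_add_mod:
  fixes c n :: nat
  shows "bij_betw (\<lambda>j. (j + c) mod n) {..<n} {..<n}"
proof -
  have "inj_on (\<lambda>j. (j + c) mod n) {..<n}"
    by (rule inj_onI) (metis cong_add_rcancel_nat cong_def lessThan_iff mod_less)
  then show ?thesis
    by (intro bij_betw_imageI endo_inj_surj) (auto intro: mod_less_divisor gr_zeroI)
qed

lemma circulant_mult_fourier_mat:
  "circulant_mat n f * fourier_mat n = fourier_mat n * mat_diag n (dft n f)"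
proof (rule eq_matI)
  let ?D = "fourier_mat n * mat_diag n (dft n f)"
  fix i l assume "i < dim_row ?D" "l < dim_col ?D"
  then have bounds: "i < n" "l < n" by (auto simp: fourier_mat_def mat_diag_def)
  have shift: "unity_root n (int j * int l)
      = unity_root n (int i * int l) * unity_root n (int ((j + (n - i)) mod n) * int l)" for j
  proof -
    have "[(j + (n - i)) mod n + i = j] (mod n)"
      using bounds by (simp add: cong_def mod_add_left_eq)
    then have "[int ((j + (n - i)) mod n) + int i = int j] (mod int n)"
      by (metis cong_int_iff of_nat_add)
    then have "unity_root n (int j * int l)
        = unity_root n ((int ((j + (n - i)) mod n) + int i) * int l)"
      using bounds by (intro unity_root_cong cong_mult) (auto intro: cong_sym)
    then show ?thesis by (simp add: distrib_right unity_root_add)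
  qed
  have "(circulant_mat n f * fourier_mat n) $$ (i, l)
      = (\<Sum>j<n. f ((j + (n - i)) mod n) * unity_root n (int j * int l))"
    using bounds by (simp add: circulant_mat_def fourier_mat_def scalar_prod_def atLeast0LessThan)
  also have "\<dots> = (\<Sum>j<n. unity_root n (int i * int l)
      * (f ((j + (n - i)) mod n) * unity_root n (int ((j + (n - i)) mod n) * int l)))"
    by (subst shift) (simp add: mult_ac)
  also have "\<dots> = unity_root n (int i * int l) * dft n f l"
    unfolding dft_def sum_distrib_left by (rule sum.reindex_bij_betw[OF bij_betw_add_mod])
  also have "\<dots> = ?D $$ (i, l)"
    using bounds by (simp add: mat_diag_mult_right[of _ n] fourier_mat_def)
  finally show "(circulant_mat n f * fourier_mat n) $$ (i, l) = ?D $$ (i, l)" .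
qed (auto simp: circulant_mat_def fourier_mat_def mat_diag_def)

lemma circulant_mat_similar_mat_diag:
  assumes "n > 0"
  shows "similar_mat (circulant_mat n f) (mat_diag n (dft n f))"
proof -
  let ?P = "fourier_mat n" and ?A = "circulant_mat n f" and ?L = "mat_diag n (dft n f)"
  obtain Q where Q: "Q \<in> carrier_mat n n" "?P * Q = 1\<^sub>m n" "Q * ?P = 1\<^sub>m n"
    using fourier_mat_invertible[OF assms] .
  show ?thesis
  proof (rule similar_matI)
    have "?A = ?A * (?P * Q)"
      using Q by (simp add: right_mult_one_mat[of _ n n])
    also have "\<dots> = ?P * ?L * Q"
      using Q(1) by (simp add: assoc_mult_mat[symmetric, of _ n n _ n _ n]
          circulant_mult_fourier_mat del: assoc_mult_mat)
    finally show "?A = ?P * ?L * Q" .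
  qed (use Q in auto)
qed

lemma Spec_circulant_mat:
  assumes "n > 0"
  shows "Spec (circulant_mat n f) = image_mset (dft n f) (mset_set {..<n})"
proof -
  let ?L = "mat_diag n (dft n f)"
  have "char_poly (circulant_mat n f) = char_poly ?L"
    by (rule char_poly_similar[OF circulant_mat_similar_mat_diag[OF assms]])
  also have "\<dots> = (\<Prod>a\<leftarrow>diag_mat ?L. [:- a, 1:])"
    by (rule char_poly_upper_triangular[of _ n]) (auto simp: mat_diag_def)
  also have "diag_mat ?L = map (dft n f) [0..<n]"
    by (auto simp: diag_mat_def mat_diag_def intro!: map_cong)
  finally have "Spec (circulant_mat n f) = proots (\<Prod>l\<in>{..<n}. [:- dft n f l, 1:])"
    by (simp add: Spec_def prod.distinct_set_conv_list[symmetric] atLeast0LessThan comp_def)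
  also have "\<dots> = (\<Sum>l\<in>{..<n}. {#dft n f l#})"
    by (subst proots_prod) auto
  also have "\<dots> = image_mset (dft n f) (mset_set {..<n})"
    by (simp add: sum_unfold_sum_mset)
  finally show ?thesis .
qed

lemma ICG_adj_eq_circulant_mat:
  assumes "n > 0"
  shows "ICG_adj n D = circulant_mat n (\<lambda>r. of_int (indicator D (gcd r n)))"
proof -
  have "(\<exists>s\<in>ICG_conn n D. s mod n = r) \<longleftrightarrow> gcd r n \<in> D" if "r < n" for r
  proof
    assume "gcd r n \<in> D"
    moreover have "gcd (if r = 0 then n else r) n = gcd r n" by simp
    ultimately have "(if r = 0 then n else r) \<in> ICG_conn n D"
      using that assms by (auto simp: ICG_conn_def Gn_def)
    then show "\<exists>s\<in>ICG_conn n D. s mod n = r"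
      using that by (metis mod_less mod_self)
  qed (auto simp: ICG_conn_def Gn_def)
  then show ?thesis
    using assms unfolding ICG_adj_def circulant_mat_def
    by (intro eq_matI) (auto simp: indicator_def)
qed

section \<open>Moebius inversion and functions of the gcd\<close>

fun moebius_transform :: "(nat \<Rightarrow> 'a::ab_group_add) \<Rightarrow> nat \<Rightarrow> 'a" where
  "moebius_transform f d = f d - (\<Sum>e | e dvd d \<and> e < d. moebius_transform f e)"

declare moebius_transform.simps [simp del]

lemma sum_divisors_remove:
  fixes d :: nat
  assumes "d > 0"
  shows "(\<Sum>e | e dvd d. g e) = g d + (\<Sum>e | e dvd d \<and> e < d. g e)"
proof -
  have "{e. e dvd d} = insert d {e. e dvd d \<and> e < d}"
    using assms by (auto dest: dvd_imp_le)
  then show ?thesis using assms by simp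
qed

lemma sum_moebius_transform:
  assumes "d > 0"
  shows "(\<Sum>e | e dvd d. moebius_transform f e) = f d"
  using assms by (simp add: sum_divisors_remove moebius_transform.simps[of f d])

lemma cong_if_sum_divisors_cong:
  fixes g1 g2 :: "nat \<Rightarrow> int"
  assumes "N > 0" and "d dvd N"
    and sums: "\<And>d. d dvd N \<Longrightarrow> [\<Sum>e | e dvd d. g1 e = \<Sum>e | e dvd d. g2 e] (mod c)"
  shows "[g1 d = g2 d] (mod c)"
  using \<open>d dvd N\<close>
proof (induction d rule: less_induct)
  case (less d)
  have "d > 0" using assms(1) less.prems by (rule dvd_pos_nat)
  have "[\<Sum>e | e dvd d \<and> e < d. g1 e = \<Sum>e | e dvd d \<and> e < d. g2 e] (mod c)"
    using less dvd_trans by (intro cong_sum) blast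
  from cong_diff[OF sums[OF less.prems] this] show ?case
    using \<open>d > 0\<close> by (simp add: sum_divisors_remove)
qed

lemma divisors_mult_prime:
  fixes N q :: nat
  assumes "prime q"
  shows "{e. e dvd N * q} = {e. e dvd N} \<union> (\<lambda>e. e * q) ` {e. e dvd N}"
proof (intro subset_antisym subsetI)
  fix e assume "e \<in> {e. e dvd N * q}"
  then have e_dvd: "e dvd N * q" by simp
  show "e \<in> {e. e dvd N} \<union> (\<lambda>e. e * q) ` {e. e dvd N}"
  proof (cases "q dvd e")
    case True
    then obtain e' where "e = q * e'" ..
    then show ?thesis using e_dvd assms by (auto simp: mult.commute[of q])
  next
    case False
    then have "coprime e q"
      using assms by (metis coprime_commute prime_imp_coprime)
    then show ?thesis using e_dvd by (simp add: coprime_dvd_mult_left_iff)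
  qed
qed auto

lemma sum_divisors_mult_prime:
  fixes N q :: nat
  assumes "prime q" and "coprime N q" and "N > 0"
  shows "(\<Sum>e | e dvd N * q. g e) = (\<Sum>e | e dvd N. g e) + (\<Sum>e | e dvd N. g (e * q))"
proof -
  have "\<not> q dvd N"
    using assms(1,2) by (metis coprime_absorb_right not_prime_unit)
  then have "{e. e dvd N} \<inter> (\<lambda>e. e * q) ` {e. e dvd N} = {}"
    by (auto dest: dvd_mult_right)
  moreover have "inj_on (\<lambda>e. e * q) {e. e dvd N}"
    using assms(1) by (simp add: inj_on_def prime_gt_0_nat)
  ultimately show ?thesis
    using assms(3) by (simp add: divisors_mult_prime[OF assms(1)] sum.union_disjoint sum.reindex)
qed

lemma moebius_transform_mult_prime:
  fixes f :: "nat \<Rightarrow> int"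
  assumes "prime q" and "coprime N q" and "N > 0" and "d dvd N"
  shows "moebius_transform f (d * q) = moebius_transform (\<lambda>d. f (d * q) - f d) d"
proof -
  have "[moebius_transform f (d * q) = moebius_transform (\<lambda>d. f (d * q) - f d) d] (mod 0)"
  proof (rule cong_if_sum_divisors_cong[OF assms(3,4)])
    fix d assume "d dvd N"
    then have d: "d > 0" "coprime d q"
      using assms(2,3) by (simp_all add: dvd_pos_nat coprime_divisors[OF _ dvd_refl])
    then have "(\<Sum>e | e dvd d * q. moebius_transform f e)
        = f d + (\<Sum>e | e dvd d. moebius_transform f (e * q))"
      using assms(1) by (simp add: sum_divisors_mult_prime sum_moebius_transform)
    then show "[\<Sum>e | e dvd d. moebius_transform f (e * q)
        = \<Sum>e | e dvd d. moebius_transform (\<lambda>d. f (d * q) - f d) e] (mod 0)"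
      using d assms(1) by (simp add: sum_moebius_transform prime_gt_0_nat)
  qed
  then show ?thesis by simp
qed

text \<open>The discrete Fourier transform of \<open>s \<mapsto> f (gcd s n)\<close>: Moebius inversion writes this function
  as a combination of the indicators of the subgroups \<open>e\<int>\<^sub>n\<close>, and the transform of such an
  indicator is \<open>n/e\<close> times the indicator of \<open>(n/e)\<int>\<^sub>n\<close>.\<close>

definition gcd_dft :: "nat \<Rightarrow> (nat \<Rightarrow> int) \<Rightarrow> nat \<Rightarrow> int" where
  "gcd_dft n f j = (\<Sum>m | m dvd n. of_bool (m dvd j) * int m * moebius_transform f (n div m))"

lemma dft_gcd:
  assumes "n > 0"
  shows "dft n (\<lambda>s. of_int (f (gcd s n))) j = of_int (gcd_dft n f j)"
proof -
  let ?g = "moebius_transform f"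
  have f_gcd: "f (gcd s n) = (\<Sum>e | e dvd n. ?g e * of_bool (e dvd s))" for s
  proof -
    have "f (gcd s n) = (\<Sum>e | e dvd gcd s n. ?g e)"
      using assms by (intro sum_moebius_transform[symmetric]) simp
    also have "\<dots> = (\<Sum>e | e dvd n. ?g e * of_bool (e dvd s))"
      using assms by (intro sum.mono_neutral_cong_left) auto
    finally show ?thesis .
  qed
  have "dft n (\<lambda>s. of_int (f (gcd s n))) j
      = (\<Sum>e | e dvd n. of_int (?g e)
        * (\<Sum>s<n. of_bool (e dvd s) * unity_root n (int s * int j)))"
    unfolding dft_def f_gcd
    by (simp only: of_int_sum of_int_mult of_int_of_bool sum_distrib_right sum_distrib_left
        mult.assoc sum.swap[of _ "{..<n}"])
  also have "\<dots> = (\<Sum>e | e dvd n. of_int (?g e) * (of_bool (n div e dvd j) * of_nat (n div e)))"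
  proof (rule sum.cong)
    fix e assume "e \<in> {e. e dvd n}"
    then obtain t where n_eq: "n = e * t" by auto
    then have "e > 0" "t > 0" using assms by simp_all
    then show "of_int (?g e) * (\<Sum>s<n. of_bool (e dvd s) * unity_root n (int s * int j))
        = of_int (?g e) * (of_bool (n div e dvd j) * of_nat (n div e))"
      using sum_unity_root_multiples[of e t j] n_eq by simp
  qed simp
  also have "\<dots> = (\<Sum>m | m dvd n. of_int (?g (n div m)) * (of_bool (m dvd j) * of_nat m))"
    by (rule sum.reindex_bij_witness[of _ "\<lambda>m. n div m" "\<lambda>e. n div e"])
      (use assms in \<open>auto elim!: dvdE\<close>)
  also have "\<dots> = of_int (gcd_dft n f j)"
    by (simp add: gcd_dft_def mult_ac)
  finally show ?thesis .
qed

lemma Spec_ICG_adj: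
  assumes "n > 0"
  shows "Spec (ICG_adj n D)
    = image_mset (\<lambda>j. of_int (gcd_dft n (indicator D) j)) (mset_set {..<n})"
  unfolding ICG_adj_eq_circulant_mat[OF assms] Spec_circulant_mat[OF assms]
  by (intro image_mset_cong dft_gcd[OF assms])

lemma Spec_ICG_adj_eq_iff:
  assumes "n > 0"
  shows "Spec (ICG_adj n D1) = Spec (ICG_adj n D2)
    \<longleftrightarrow> image_mset (gcd_dft n (indicator D1)) (mset_set {..<n})
      = image_mset (gcd_dft n (indicator D2)) (mset_set {..<n})"
proof -
  have "Spec (ICG_adj n D)
      = image_mset of_int (image_mset (gcd_dft n (indicator D)) (mset_set {..<n}))" for D
    using assms by (simp add: Spec_ICG_adj multiset.map_comp comp_def)
  moreover have "inj (image_mset (of_int :: int \<Rightarrow> complex))"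
    by (intro multiset.inj_map) (simp add: inj_on_def)
  ultimately show ?thesis by (simp add: inj_eq)
qed

lemma gcd_dft_0:
  assumes "n > 0"
  shows "gcd_dft n f 0 = (\<Sum>s<n. f (gcd s n))"
proof -
  have "(of_int (gcd_dft n f 0) :: complex) = of_int (\<Sum>s<n. f (gcd s n))"
    using assms by (simp add: dft_gcd[symmetric] dft_def)
  then show ?thesis by (simp only: of_int_eq_iff)
qed

lemma gcd_dft_le_gcd_dft_0:
  assumes "n > 0" and "\<And>d. f d \<ge> 0"
  shows "gcd_dft n f j \<le> gcd_dft n f 0"
proof -
  have "norm (of_int (gcd_dft n f j) :: complex) \<le> (\<Sum>s<n. of_int (f (gcd s n)))"
    unfolding dft_gcd[OF assms(1), symmetric] dft_def
    using assms(2) by (intro sum_norm_le) (simp add: norm_mult)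
  then have "real_of_int \<bar>gcd_dft n f j\<bar> \<le> of_int (gcd_dft n f 0)"
    using assms(1) by (simp add: gcd_dft_0)
  then show ?thesis by linarith
qed

lemma Max_gcd_dft:
  assumes "n > 0" and "\<And>d. f d \<ge> 0"
  shows "Max (gcd_dft n f ` {..<n}) = gcd_dft n f 0"
  using assms(1) gcd_dft_le_gcd_dft_0[OF assms] by (intro Max_eqI) auto

lemma gcd_dft_0_eq_if_mset_eq:
  assumes "n > 0" and "\<And>d. f1 d \<ge> 0" and "\<And>d. f2 d \<ge> 0"
    and "image_mset (gcd_dft n f1) (mset_set {..<n}) = image_mset (gcd_dft n f2) (mset_set {..<n})"
  shows "gcd_dft n f1 0 = gcd_dft n f2 0"
proof -
  have "gcd_dft n f1 ` {..<n} = gcd_dft n f2 ` {..<n}"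
    using arg_cong[OF assms(4), of set_mset] by simp
  then show ?thesis
    using Max_gcd_dft[of n f1] Max_gcd_dft[of n f2] assms(1-3) by simp
qed

lemma gcd_dft_gcd: "gcd_dft n f (gcd j n) = gcd_dft n f j"
  unfolding gcd_dft_def by (intro sum.cong) auto

lemma gcd_dft_mult_prime:
  assumes "prime q" and "coprime N q" and "N > 0"
  shows "gcd_dft (N * q) f j
    = gcd_dft N (\<lambda>d. f (d * q) - f d) j + of_bool (q dvd j) * int q * gcd_dft N f j"
proof -
  let ?t = "\<lambda>m. of_bool (m dvd j) * int m * moebius_transform f (N * q div m)"
  have "gcd_dft (N * q) f j = (\<Sum>m | m dvd N. ?t m) + (\<Sum>m | m dvd N. ?t (m * q))"
    unfolding gcd_dft_def by (rule sum_divisors_mult_prime[OF assms])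
  also have "(\<Sum>m | m dvd N. ?t m) = gcd_dft N (\<lambda>d. f (d * q) - f d) j"
    unfolding gcd_dft_def
  proof (rule sum.cong)
    fix m assume "m \<in> {m. m dvd N}"
    then obtain e where "N = m * e" by auto
    then have quotient: "N * q div m = N div m * q" "N div m dvd N"
      using assms(3) by simp_all
    then show "?t m = of_bool (m dvd j) * int m * moebius_transform (\<lambda>d. f (d * q) - f d) (N div m)"
      by (simp only: quotient moebius_transform_mult_prime[OF assms quotient(2)])
  qed simp
  also have "(\<Sum>m | m dvd N. ?t (m * q)) = of_bool (q dvd j) * int q * gcd_dft N f j"
    unfolding gcd_dft_def sum_distrib_left
  proof (rule sum.cong)
    fix m assume "m \<in> {m. m dvd N}"
    then have "coprime m q" using assms(2) by (simp add: coprime_divisors[OF _ dvd_refl])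
    then have "m * q dvd j \<longleftrightarrow> m dvd j \<and> q dvd j"
      by (auto intro: divides_mult dest: dvd_mult_left dvd_mult_right)
    moreover have "N * q div (m * q) = N div m"
      using assms(1) by (simp add: prime_gt_0_nat)
    ultimately show "?t (m * q) = of_bool (q dvd j) * int q
        * (of_bool (m dvd j) * int m * moebius_transform f (N div m))"
      by (simp add: of_bool_conj mult_ac)
  qed simp
  finally show ?thesis .
qed

lemma cong_if_gcd_dft_cong:
  assumes "N > 0" and "coprime (int N) c" and "d dvd N"
    and dft: "\<And>j. j dvd N \<Longrightarrow> [gcd_dft N f1 j = gcd_dft N f2 j] (mod c)"
  shows "[f1 d = f2 d] (mod c)"
proof -
  have moebius_cong: "[moebius_transform f1 e = moebius_transform f2 e] (mod c)" if "e dvd N" for e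
  proof -
    let ?m = "N div e"
    have cofactor: "?m dvd N" "N div ?m = e" using that assms(1) by auto
    have "[int ?m * moebius_transform f1 (N div ?m)
        = int ?m * moebius_transform f2 (N div ?m)] (mod c)"
    proof (rule cong_if_sum_divisors_cong[OF assms(1) cofactor(1)])
      fix j assume j_dvd: "j dvd N"
      have "gcd_dft N f j = (\<Sum>m | m dvd j. int m * moebius_transform f (N div m))" for f
        unfolding gcd_dft_def using j_dvd assms(1)
        by (intro sum.mono_neutral_cong_right) (auto intro: dvd_trans)
      then show "[\<Sum>m | m dvd j. int m * moebius_transform f1 (N div m)
          = \<Sum>m | m dvd j. int m * moebius_transform f2 (N div m)] (mod c)"
        using dft[OF j_dvd] by simp
    qed
    moreover have "coprime (int ?m) c"
      using assms(2) cofactor(1) coprime_divisors[of "int ?m" "int N" c c] by simp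
    ultimately show ?thesis using cofactor(2) by (simp add: cong_mult_lcancel)
  qed
  have "d > 0" using assms(1,3) by (rule dvd_pos_nat)
  have "[\<Sum>e | e dvd d. moebius_transform f1 e = \<Sum>e | e dvd d. moebius_transform f2 e] (mod c)"
    using moebius_cong assms(3) dvd_trans by (intro cong_sum) blast
  then show ?thesis using \<open>d > 0\<close> by (simp add: sum_moebius_transform)
qed

section \<open>Sizes of the gcd classes\<close>

lemma sum_gcd_eq_sum_totient:
  fixes f :: "nat \<Rightarrow> nat"
  assumes "N > 0"
  shows "(\<Sum>j<M * N. f (gcd j N)) = M * (\<Sum>d | d dvd N. totient (N div d) * f d)"
proof -
  have period: "(\<Sum>j = m * N..<m * N + N. f (gcd j N)) = (\<Sum>r\<in>{0<..N}. f (gcd r N))" for m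
  proof -
    have "(\<Sum>j = m * N..<m * N + N. f (gcd j N)) = (\<Sum>r<N. f (gcd (r + m * N) N))"
      using sum.shift_bounds_nat_ivl[of "\<lambda>j. f (gcd j N)" 0 "m * N" N]
      by (simp add: atLeast0LessThan add.commute)
    also have "\<dots> = (\<Sum>r<N. f (gcd r N))"
      by (simp add: gcd.commute[of _ N] add.commute[of _ "m * N"] gcd_add_mult)
    also have "\<dots> = (\<Sum>r\<in>{0<..N}. f (gcd r N))"
      by (rule sum.reindex_bij_witness[of _ "\<lambda>r. r mod N" "\<lambda>r. if r = 0 then N else r"])
        (use assms in \<open>auto simp: le_less\<close>)
    finally show ?thesis .
  qed
  have "(\<Sum>j<M * N. f (gcd j N)) = M * (\<Sum>r\<in>{0<..N}. f (gcd r N))"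
    by (simp add: sum.nat_group[symmetric] period)
  also have "(\<Sum>r\<in>{0<..N}. f (gcd r N))
      = (\<Sum>d | d dvd N. \<Sum>r | r \<in> {0<..N} \<and> gcd r N = d. f (gcd r N))"
    using assms by (intro sum.group[symmetric]) auto
  also have "\<dots> = (\<Sum>d | d dvd N. totient (N div d) * f d)"
    using assms by (intro sum.cong) (simp_all add: card_gcd_eq_totient[symmetric])
  finally show ?thesis .
qed

lemma eq_if_superincreasing_weights:
  fixes w :: "nat \<Rightarrow> nat" and a b :: "nat \<Rightarrow> 'a"
  assumes "\<And>i. i < k \<Longrightarrow> (\<Sum>l<i. w l) < w i"
    and "\<And>v. (\<Sum>i<k. w i * of_bool (a i = v)) = (\<Sum>i<k. w i * of_bool (b i = v))"
    and "i < k"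
  shows "a i = b i"
  using assms
proof (induction k)
  case (Suc k)
  have last_eq: "a k = b k"
  proof (rule ccontr)
    assume "a k \<noteq> b k"
    have "w k \<le> (\<Sum>i<Suc k. w i * of_bool (a i = a k))" by simp
    also have "\<dots> = (\<Sum>i<k. w i * of_bool (b i = a k))"
      unfolding Suc.prems(2) using \<open>a k \<noteq> b k\<close> by simp
    also have "\<dots> \<le> (\<Sum>i<k. w i)" by (intro sum_mono) simp
    also have "\<dots> < w k" using Suc.prems(1) by simp
    finally show False by simp
  qed
  have "(\<Sum>i<k. w i * of_bool (a i = v)) = (\<Sum>i<k. w i * of_bool (b i = v))" for v
    using Suc.prems(2)[of v] last_eq by simp
  then show ?case
    using Suc.IH Suc.prems(1,3) last_eq by (cases "i = k") auto
qed simp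

lemma sum_totient_prime_power_less:
  assumes "prime p"
  shows "(\<Sum>l<i. totient (p ^ Suc l)) < totient (p ^ Suc i)"
proof -
  have "p \<ge> 2" using assms by (rule prime_ge_2_nat)
  have "Suc (\<Sum>l<i. totient (p ^ Suc l)) = p ^ i"
  proof (induction i)
    case (Suc i)
    have "Suc (\<Sum>l<Suc i. totient (p ^ Suc l)) = p ^ i + p ^ i * (p - 1)"
      using Suc assms totient_prime_power_Suc by simp
    then show ?case using \<open>p \<ge> 2\<close> by (simp add: algebra_simps)
  qed simp
  also have "p ^ i \<le> totient (p ^ Suc i)"
    using \<open>p \<ge> 2\<close> by (simp add: totient_prime_power_Suc[OF assms] del: power_Suc)
  finally show ?thesis by simp
qed

lemma count_image_mset_mset_set:
  assumes "finite A"
  shows "count (image_mset f (mset_set A)) v = (\<Sum>x\<in>A. of_bool (f x = v))"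
  using assms by (induction A rule: finite_induct) simp_all

lemma sum_divisors_prime_power:
  fixes p :: nat
  assumes "prime p"
  shows "(\<Sum>d | d dvd p ^ k. h d) = (\<Sum>i\<le>k. h (p ^ i))"
proof -
  have "{d. d dvd p ^ k} = (\<lambda>i. p ^ i) ` {..k}"
    using assms by (auto simp: divides_primepow_nat)
  moreover have "inj_on (\<lambda>i. p ^ i) {..k}"
    using prime_gt_1_nat[OF assms] by (simp add: inj_on_def)
  ultimately show ?thesis by (simp add: sum.reindex)
qed

lemma sum_totient_divisors_prime_power:
  fixes h :: "nat \<Rightarrow> nat"
  assumes "prime p"
  shows "(\<Sum>d | d dvd p ^ k. totient (p ^ k div d) * h d)
    = h (p ^ k) + (\<Sum>i<k. totient (p ^ Suc i) * h (p ^ (k - Suc i)))"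
proof -
  have "p > 0" using assms by (rule prime_gt_0_nat)
  have "(\<Sum>d | d dvd p ^ k. totient (p ^ k div d) * h d)
      = (\<Sum>i\<le>k. totient (p ^ (k - i)) * h (p ^ i))"
    using \<open>p > 0\<close> by (simp add: sum_divisors_prime_power[OF assms] power_diff)
  also have "\<dots> = h (p ^ k) + (\<Sum>i<k. totient (p ^ (k - i)) * h (p ^ i))"
    by (simp add: lessThan_Suc_atMost[symmetric])
  also have "(\<Sum>i<k. totient (p ^ (k - i)) * h (p ^ i))
      = (\<Sum>i<k. totient (p ^ Suc i) * h (p ^ (k - Suc i)))"
    by (subst sum.nat_diff_reindex[symmetric], rule sum.cong)
      (simp_all add: Suc_le_eq del: power_Suc)
  finally show ?thesis .
qed

text \<open>The class \<open>gcd j (p\<^sup>k) = p\<^sup>k\<close> is excluded by hypothesis: for \<open>p = 2\<close> it has the same size as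
  the class \<open>gcd j (p\<^sup>k) = p\<^bsup>k-1\<^esup>\<close>.\<close>

lemma eq_if_image_mset_gcd_prime_power_eq:
  fixes p k M :: nat and a b :: "nat \<Rightarrow> 'a"
  assumes "prime p" and "M > 0" and top: "a (p ^ k) = b (p ^ k)" and "d dvd p ^ k"
    and mset: "image_mset (\<lambda>j. a (gcd j (p ^ k))) (mset_set {..<M * p ^ k})
      = image_mset (\<lambda>j. b (gcd j (p ^ k))) (mset_set {..<M * p ^ k})"
  shows "a d = b d"
proof -
  have count: "count (image_mset (\<lambda>j. c (gcd j (p ^ k))) (mset_set {..<M * p ^ k})) v
      = M * (of_bool (c (p ^ k) = v)
        + (\<Sum>i<k. totient (p ^ Suc i) * of_bool (c (p ^ (k - Suc i)) = v)))"
    for c :: "nat \<Rightarrow> 'a" and v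
  proof -
    have "p ^ k > 0" using assms(1) by (simp add: prime_gt_0_nat)
    then show ?thesis
      by (simp only: count_image_mset_mset_set finite_lessThan
          sum_gcd_eq_sum_totient[where f = "\<lambda>d. of_bool (c d = v)"]
          sum_totient_divisors_prime_power[OF assms(1)])
  qed
  have "(\<Sum>i<k. totient (p ^ Suc i) * of_bool (a (p ^ (k - Suc i)) = v))
      = (\<Sum>i<k. totient (p ^ Suc i) * of_bool (b (p ^ (k - Suc i)) = v))" for v
    using count[of a v] count[of b v] \<open>M > 0\<close> unfolding mset top by simp
  then have below: "a (p ^ (k - Suc i)) = b (p ^ (k - Suc i))" if "i < k" for i
    using that by (rule eq_if_superincreasing_weights[OF sum_totient_prime_power_less[OF assms(1)]])
  obtain m where m: "m \<le> k" "d = p ^ m"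
    using assms(1,4) by (auto simp: divides_primepow_nat)
  show ?thesis
  proof (cases "m = k")
    case False
    then have "k - Suc (k - Suc m) = m" using m(1) by simp
    then show ?thesis using below[of "k - Suc m"] m False by simp
  qed (use m top in simp)
qed

lemma image_mset_eq_if_card_eq:
  fixes P Q :: "'a \<Rightarrow> bool"
  assumes "finite A" and "card {x \<in> A. P x} = card {x \<in> A. Q x}"
  shows "image_mset P (mset_set A) = image_mset Q (mset_set A)"
proof (rule multiset_eqI)
  fix v
  have "count (image_mset R (mset_set A)) v
      = (if v then card {x \<in> A. R x} else card A - card {x \<in> A. R x})" for R :: "'a \<Rightarrow> bool"
  proof -
    have "{x \<in> A. \<not> R x} = A - {x \<in> A. R x}" by auto
    then show ?thesis
      using assms(1) by (cases v) (simp_all add: count_image_mset_mset_set card_Diff_subset Int_def)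
  qed
  then show "count (image_mset P (mset_set A)) v = count (image_mset Q (mset_set A)) v"
    using assms(2) by simp
qed

lemma mem_iff_if_card_gcd_mem_prime_power_eq:
  fixes p k :: nat
  assumes "prime p" and "p ^ k \<in> A \<longleftrightarrow> p ^ k \<in> B" and "d dvd p ^ k"
    and "card {s \<in> {..<p ^ k}. gcd s (p ^ k) \<in> A} = card {s \<in> {..<p ^ k}. gcd s (p ^ k) \<in> B}"
  shows "d \<in> A \<longleftrightarrow> d \<in> B"
proof -
  have "image_mset (\<lambda>s. gcd s (p ^ k) \<in> A) (mset_set {..<p ^ k})
      = image_mset (\<lambda>s. gcd s (p ^ k) \<in> B) (mset_set {..<p ^ k})"
    using finite_lessThan assms(4) by (rule image_mset_eq_if_card_eq)
  then show ?thesis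
    using eq_if_image_mset_gcd_prime_power_eq[of p 1 "\<lambda>d. d \<in> A" k "\<lambda>d. d \<in> B" d] assms(1-3)
    by simp
qed

section \<open>Recovering the divisor set from the spectrum\<close>

lemma mset_gcd_dft_eq_imp_diff_eq:
  fixes f1 f2 :: "nat \<Rightarrow> int"
  assumes "prime p" and "prime q" and "p \<noteq> q" and "d dvd p ^ k"
    and mset: "image_mset (gcd_dft (p ^ k * q) f1) (mset_set {..<p ^ k * q})
      = image_mset (gcd_dft (p ^ k * q) f2) (mset_set {..<p ^ k * q})"
    and zero: "gcd_dft (p ^ k * q) f1 0 = gcd_dft (p ^ k * q) f2 0"
    and small: "\<bar>(f1 (d * q) - f1 d) - (f2 (d * q) - f2 d)\<bar> < int q"
  shows "f1 (d * q) - f1 d = f2 (d * q) - f2 d"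
proof -
  let ?N = "p ^ k" and ?diff = "\<lambda>f d. f (d * q) - f d :: int"
  have N: "?N > 0" "coprime ?N q" "coprime (int ?N) (int q)"
    using assms(1-3) by (simp_all add: prime_gt_0_nat primes_coprime)
  have mod_q: "gcd_dft (?N * q) f j mod int q = gcd_dft ?N (?diff f) (gcd j ?N) mod int q" for f j
    by (simp add: gcd_dft_mult_prime[OF assms(2) N(2,1)] gcd_dft_gcd mult.assoc
        mult.left_commute[of _ "int q"])
  have "gcd_dft ?N (?diff f1) e mod int q = gcd_dft ?N (?diff f2) e mod int q" if "e dvd ?N" for e
  proof (rule eq_if_image_mset_gcd_prime_power_eq[OF assms(1) _ _ that])
    show "gcd_dft ?N (?diff f1) ?N mod int q = gcd_dft ?N (?diff f2) ?N mod int q"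
      using mod_q[of f1 0] mod_q[of f2 0] zero by simp
    have "image_mset (\<lambda>x. x mod int q) (image_mset (gcd_dft (?N * q) f1) (mset_set {..<?N * q}))
        = image_mset (\<lambda>x. x mod int q) (image_mset (gcd_dft (?N * q) f2) (mset_set {..<?N * q}))"
      by (simp only: mset)
    then show "image_mset (\<lambda>j. gcd_dft ?N (?diff f1) (gcd j ?N) mod int q) (mset_set {..<q * ?N})
        = image_mset (\<lambda>j. gcd_dft ?N (?diff f2) (gcd j ?N) mod int q) (mset_set {..<q * ?N})"
      by (simp add: multiset.map_comp comp_def mod_q mult.commute[of q])
  qed (use assms(2) in \<open>simp add: prime_gt_0_nat\<close>)
  then have "[?diff f1 d = ?diff f2 d] (mod int q)"
    by (rule cong_if_gcd_dft_cong[OF N(1,3) assms(4), unfolded cong_def[of "gcd_dft _ _ _"]])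
  then have "int q dvd ?diff f1 d - ?diff f2 d" by (simp only: cong_iff_dvd_diff)
  then show ?thesis
    using small dvd_imp_le_int[of "?diff f1 d - ?diff f2 d" "int q"] by fastforce
qed

lemma sum_gcd_eq_if_diff_eq:
  fixes f1 f2 :: "nat \<Rightarrow> int"
  assumes "prime q" and "coprime N q" and "N > 0"
    and diff: "\<And>d. d dvd N \<Longrightarrow> f1 (d * q) - f1 d = f2 (d * q) - f2 d"
    and zero: "gcd_dft (N * q) f1 0 = gcd_dft (N * q) f2 0"
  shows "(\<Sum>s<N. f1 (gcd s N)) = (\<Sum>s<N. f2 (gcd s N))"
proof -
  have "gcd_dft N (\<lambda>d. f1 (d * q) - f1 d) 0 = gcd_dft N (\<lambda>d. f2 (d * q) - f2 d) 0"
    by (simp add: gcd_dft_0[OF assms(3)] diff)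
  then have "int q * gcd_dft N f1 0 = int q * gcd_dft N f2 0"
    using zero by (simp add: gcd_dft_mult_prime[OF assms(1-3)])
  then show ?thesis
    using assms(1) by (simp add: gcd_dft_0[OF assms(3)] prime_gt_0_nat)
qed

theorem Spec_ICG_adj_inj_prime_power_times_prime:
  fixes p q n k :: nat
  assumes "prime p" and "prime q" and "p \<noteq> q" and "q \<noteq> 2" and n: "n = p ^ k * q"
    and D1: "D1 \<subseteq> {d. d dvd n} - {n}" and D2: "D2 \<subseteq> {d. d dvd n} - {n}"
    and spec: "Spec (ICG_adj n D1) = Spec (ICG_adj n D2)"
  shows "D1 = D2"
proof -
  let ?N = "p ^ k" and ?ind = "\<lambda>D. indicator D :: nat \<Rightarrow> int"
  have "q \<ge> 3" using assms(2,4) prime_ge_2_nat[of q] by simp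
  have N: "?N > 0" "coprime ?N q"
    using assms(1-3) by (simp_all add: prime_gt_0_nat primes_coprime)
  have "n > 0" using N(1) \<open>q \<ge> 3\<close> n by simp
  have eigenvalues: "image_mset (gcd_dft n (?ind D1)) (mset_set {..<n})
      = image_mset (gcd_dft n (?ind D2)) (mset_set {..<n})"
    using spec by (simp only: Spec_ICG_adj_eq_iff[OF \<open>n > 0\<close>])
  then have degree: "gcd_dft n (?ind D1) 0 = gcd_dft n (?ind D2) 0"
    by (rule gcd_dft_0_eq_if_mset_eq[OF \<open>n > 0\<close> indicator_pos_le indicator_pos_le])
  have diff: "?ind D1 (d * q) - ?ind D1 d = ?ind D2 (d * q) - ?ind D2 d" if "d dvd ?N" for d
  proof (rule mset_gcd_dft_eq_imp_diff_eq[OF assms(1-3) that eigenvalues[unfolded n]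
        degree[unfolded n]])
    show "\<bar>(?ind D1 (d * q) - ?ind D1 d) - (?ind D2 (d * q) - ?ind D2 d)\<bar> < int q"
      using \<open>q \<ge> 3\<close> by (simp add: indicator_def of_bool_def)
  qed
  have "?N * q \<notin> D1" "?N * q \<notin> D2" using D1 D2 n by auto
  then have N_mem: "?N \<in> D1 \<longleftrightarrow> ?N \<in> D2"
    using diff[of ?N] by (simp add: indicator_def of_bool_def split: if_splits)
  have "(\<Sum>s<?N. ?ind D1 (gcd s ?N)) = (\<Sum>s<?N. ?ind D2 (gcd s ?N))"
    by (rule sum_gcd_eq_if_diff_eq[OF assms(2) N(2,1) diff degree[unfolded n]])
  then have "card {s \<in> {..<?N}. gcd s ?N \<in> D1} = card {s \<in> {..<?N}. gcd s ?N \<in> D2}"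
    by (simp add: indicator_def Int_def)
  then have divisor_mem: "d \<in> D1 \<longleftrightarrow> d \<in> D2" if "d dvd ?N" for d
    by (rule mem_iff_if_card_gcd_mem_prime_power_eq[OF assms(1) N_mem that])
  moreover have "d * q \<in> D1 \<longleftrightarrow> d * q \<in> D2" if "d dvd ?N" for d
    using diff[OF that] divisor_mem[OF that]
    by (simp add: indicator_def of_bool_def split: if_splits)
  ultimately have "d \<in> D1 \<longleftrightarrow> d \<in> D2" if "d \<in> {d. d dvd n}" for d
    using that unfolding n divisors_mult_prime[OF assms(2)] by auto
  then show ?thesis using D1 D2 by blast
qed

theorem theorem1p4:
  fixes p q n :: nat and D1 D2 :: "nat set"
  assumes "prime p" and "prime q" and "2 \<le> p" and "p < q"
    and "n = p ^ 3 * q"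
    and "D1 \<subseteq> {d. d dvd n} - {n}"
    and "D2 \<subseteq> {d. d dvd n} - {n}"
    and "Spec (ICG_adj n D1) = Spec (ICG_adj n D2)"
  shows "D1 = D2"
  using assms by (intro Spec_ICG_adj_inj_prime_power_times_prime[of p q n 3 D1 D2]) auto

end
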